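(* There are compact subsets of the plane $\mathbb{R}^2$ having property (K) without being trivial (K)-sets.
   Context: Identify the plane $\mathbb{R}^2$ with $\mathbb{C}$. A rigid motion is an orientation-preserving isometry of the plane (a translation or a rotation), i.e. a map $x\mapsto ux+c$ with $u,c\in\mathbb{C}$, $|u|=1$. The identity map is denoted by $j$. A continuous movement $M$ is a map $t\mapsto M_t$ ($t\in[0,1]$) such that $M_t$ is a rigid motion for every $t\in[0,1]$, the map $(t,x)\mapsto M_t(x)$ is continuous on $[0,1]\times\mathbb{R}^2$, and $M_0=j$. For a set $A\subset\mathbb{R}^2$ put $W_M(A)=\{M_t(x)\colon t\in[0,1],\ x\in A\}$. Let $\lambda$ denote two-dimensional Lebesgue measure. The set $A$ has property (K) (the Kakeya property) if there is a rigid motion $\alpha\ne j$ such that for every $\varepsilon>0$ there exists a continuous movement $M$ with $M_1=\alpha$ and $\lambda(W_M(A))<\varepsilon$. A set $A\subset\mathbb{R}^2$ is a trivial (K)-set if $A$ can be covered by a null set (a set of two-dimensional Lebesgue measure zero) which is either the union of parallel lines or the union of concentric circles. *)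

theory Defs
  imports "HOL-Analysis.Analysis"
begin

definition rigid_motion :: "(complex \<Rightarrow> complex) \<Rightarrow> bool" where
  "rigid_motion f \<longleftrightarrow> (\<exists>u c. cmod u = 1 \<and> f = (\<lambda>x. u * x + c))"

(* The values of M at times outside [0,1] are irrelevant. *)
definition continuous_movement :: "(real \<Rightarrow> complex \<Rightarrow> complex) \<Rightarrow> bool" where
  "continuous_movement M \<longleftrightarrow>
     (\<forall>t\<in>{0..1}. rigid_motion (M t)) \<and>
     continuous_on ({0..1} \<times> UNIV) (\<lambda>(t, x). M t x) \<and>
     M 0 = id"

definition swept_set :: "(real \<Rightarrow> complex \<Rightarrow> complex) \<Rightarrow> complex set \<Rightarrow> complex set" where
  "swept_set M A = {M t x | t x. t \<in> {0..1} \<and> x \<in> A}"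

(* Membership in lmeasurable (measurable with finite measure) is needed because measure
   returns 0 on non-measurable sets and on sets of infinite measure. It holds
   automatically when A is compact, since then the swept set is compact. *)
definition kakeya_property :: "complex set \<Rightarrow> bool" where
  "kakeya_property A \<longleftrightarrow>
     (\<exists>\<alpha>. rigid_motion \<alpha> \<and> \<alpha> \<noteq> id \<and>
       (\<forall>\<epsilon>>0. \<exists>M. continuous_movement M \<and> M 1 = \<alpha> \<and>
          swept_set M A \<in> lmeasurable \<and> measure lebesgue (swept_set M A) < \<epsilon>))"

definition line_through :: "complex \<Rightarrow> complex \<Rightarrow> complex set" where
  "line_through p v = {p + of_real s * v | s. True}"

definition union_of_parallel_lines :: "complex set \<Rightarrow> bool" where
  "union_of_parallel_lines N \<longleftrightarrow> (\<exists>v P. v \<noteq> 0 \<and> N = (\<Union>p\<in>P. line_through p v))"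

(* Radius 0 is allowed, so the common centre may itself belong to the union. Otherwise a
   circle together with its centre would not count as a trivial (K)-set. *)
definition union_of_concentric_circles :: "complex set \<Rightarrow> bool" where
  "union_of_concentric_circles N \<longleftrightarrow> (\<exists>c R. R \<subseteq> {0..} \<and> N = (\<Union>r\<in>R. sphere c r))"

definition trivial_K_set :: "complex set \<Rightarrow> bool" where
  "trivial_K_set A \<longleftrightarrow>
     (\<exists>N. N \<in> null_sets lebesgue \<and> A \<subseteq> N \<and>
       (union_of_parallel_lines N \<or> union_of_concentric_circles N))"

end

(*
  The projection length of a compact set is only upper semicontinuous in the direction. We
  take a compact set whose projections along the directions (-2^-n, 1) have length tending to 0,
  although its projection along the limit direction (0, 1) contains [0, 1): it contains
  the graph of a function cutting off, at scale 2^-n^2, the variation of x from x + y / 2^n.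
  Moving by -(-2^-n, 1) and then by 2 (-2^-(n+1), 1) translates the set by (0, 1) and
  sweeps little area. The vertical segment {0} x [0, 1], whose projections along (-2^-n, 1)
  are also short, can be added to the set. Its projections along all nonvertical directions
  and its distance sets from all centres are not null, which rules out a trivial (K)-set.
*)
theory Submission
  imports Defs
begin

section \<open>The graph, its approximations and the compact set\<close>

definition dyadic_floor :: "nat \<Rightarrow> real \<Rightarrow> real" where
  "dyadic_floor n x = of_int \<lfloor>2 ^ n\<^sup>2 * x\<rfloor> / 2 ^ n\<^sup>2"

text \<open>The contribution to \<open>x\<close> of its binary digits at positions n^2 + 1 to
  (n+1)^2. Blocks of growing length leave the weights 2^n of \<open>height\<close> summable and make
  later blocks negligible even against the 2^(n^2) values of the earlier ones.\<close>

definition dyadic_step :: "nat \<Rightarrow> real \<Rightarrow> real" where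
  "dyadic_step n x = dyadic_floor (Suc n) x - dyadic_floor n x"

definition height :: "real \<Rightarrow> real" where
  "height x = - (\<Sum>n. 2 ^ n * dyadic_step n x)"

text \<open>The part of \<open>x + height x / 2 ^ n\<close> that comes from the blocks before the
  n-th. It depends on \<open>x\<close> only through \<open>dyadic_floor n x\<close>, so grid points
  represent all its values.\<close>

definition coarse :: "nat \<Rightarrow> real \<Rightarrow> real" where
  "coarse n x = dyadic_floor n x - (\<Sum>m<n. 2 ^ m * dyadic_step m x) / 2 ^ n"

text \<open>
  A compact set of small measure containing the values of x + y / 2^n both for the points (x, y)
  of the graph of \<^const>\<open>height\<close> over [0, 1) (the intervals) and for those of the vertical segment
  (the set {0..1 / 2^n}). In \<open>x + height x / 2^n\<close> the n-th digit block of x cancels, the earlier blocks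
  take 2^(n^2) values, and the later ones contribute at most O(2^-(n+1)^2).
\<close>

definition shadow :: "nat \<Rightarrow> real set" where
  "shadow n = (\<Union>k<2 ^ n\<^sup>2. {coarse n (real k / 2 ^ n\<^sup>2) - 4 / 2 ^ (Suc n)\<^sup>2 ..
                              coarse n (real k / 2 ^ n\<^sup>2) + 1 / 2 ^ (Suc n)\<^sup>2})
     \<union> {0..1 / 2 ^ n}"

text \<open>Imposing the projection conditions directly, instead of closing up the graph, makes the
  set closed and bounds its projections at once. The box leaves room for the graph, by
  \<open>height_bound\<close>.\<close>

definition kset :: "complex set" where
  "kset = {z. \<bar>Re z\<bar> \<le> 1 \<and> \<bar>Im z\<bar> \<le> 3 \<and> (\<forall>n. Re z + Im z / 2 ^ n \<in> shadow n)}"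

section \<open>Dyadic floors and the series for the height\<close>

lemma dyadic_floor_le: "dyadic_floor n x \<le> x"
  unfolding dyadic_floor_def by (simp add: field_simps)

lemma dyadic_floor_gt: "x < dyadic_floor n x + 1 / 2 ^ n\<^sup>2"
  unfolding dyadic_floor_def by (simp add: field_simps) linarith

lemma floor_coarser:
  assumes "m \<le> n"
  shows "\<lfloor>2 ^ m * x\<rfloor> = \<lfloor>2 ^ n * (x::real)\<rfloor> div 2 ^ (n - m)"
proof -
  have "2 ^ m * x = 2 ^ n * x / of_int (2 ^ (n - m))"
    unfolding of_int_power of_int_numeral using assms by (subst power_diff) auto
  then show ?thesis
    using floor_divide_real_eq_div[of "2 ^ (n - m)" "2 ^ n * x"] by simp
qed

lemma dyadic_floor_cong:
  assumes "dyadic_floor n x = dyadic_floor n y" "m \<le> n"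
  shows "dyadic_floor m x = dyadic_floor m y"
proof -
  have "\<lfloor>2 ^ n\<^sup>2 * x\<rfloor> = \<lfloor>2 ^ n\<^sup>2 * y\<rfloor>"
    using assms(1) by (simp add: dyadic_floor_def)
  moreover have "m\<^sup>2 \<le> n\<^sup>2"
    using assms(2) by (simp add: power_mono)
  ultimately show ?thesis
    unfolding dyadic_floor_def by (simp add: floor_coarser[of "m\<^sup>2" "n\<^sup>2"])
qed

lemma dyadic_floor_dyadic: "dyadic_floor n (of_int k / 2 ^ n\<^sup>2) = of_int k / 2 ^ n\<^sup>2"
  by (simp add: dyadic_floor_def)

lemma dyadic_step_bounds:
  shows dyadic_step_nonneg: "0 \<le> dyadic_step n x"
    and dyadic_step_le: "dyadic_step n x \<le> 1 / 2 ^ n\<^sup>2"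
proof -
  \<comment> \<open>The coarser grid is contained in the finer one: by \<open>floor_coarser\<close>
    the left side is the finer floor minus its remainder.\<close>
  have "\<lfloor>2 ^ n\<^sup>2 * x\<rfloor> * 2 ^ ((Suc n)\<^sup>2 - n\<^sup>2) \<le> \<lfloor>2 ^ (Suc n)\<^sup>2 * x\<rfloor>"
    by (subst floor_coarser[of "n\<^sup>2" "(Suc n)\<^sup>2"])
       (simp_all add: power_mono minus_mod_eq_div_mult [symmetric] del: power_Suc)
  then have "real_of_int (\<lfloor>2 ^ n\<^sup>2 * x\<rfloor> * 2 ^ ((Suc n)\<^sup>2 - n\<^sup>2)) \<le> \<lfloor>2 ^ (Suc n)\<^sup>2 * x\<rfloor>"
    by linarith
  moreover have "(2::real) ^ ((Suc n)\<^sup>2 - n\<^sup>2) = 2 ^ (Suc n)\<^sup>2 / 2 ^ n\<^sup>2"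
    by (simp add: power_diff power_mono)
  ultimately show "0 \<le> dyadic_step n x"
    by (simp add: dyadic_step_def dyadic_floor_def field_simps)
  show "dyadic_step n x \<le> 1 / 2 ^ n\<^sup>2"
    using dyadic_floor_le[of "Suc n" x] dyadic_floor_gt[of x n] by (simp add: dyadic_step_def)
qed

text \<open>Separates a factor for the start \<open>n\<close> of a tail from a geometric factor in
  \<open>m\<close>. It rests on 2 m + n^2 \<le> (m + n)^2, which uses n \<ge> 1.\<close>

lemma height_term_le:
  assumes "1 \<le> n"
  shows "2 ^ (m + n) * dyadic_step (m + n) x \<le> (1 / 2 ^ (n * (n - 1))) * (1 / 2) ^ m"
proof -
  obtain k where "n = Suc k"
    using assms by (cases n) auto
  then have "m + n + m + n * (n - 1) \<le> (m + n)\<^sup>2"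
    by (simp add: power2_eq_square algebra_simps)
  then have "(2::real) ^ (m + n + m + n * (n - 1)) \<le> 2 ^ (m + n)\<^sup>2"
    by (rule power_increasing) simp
  then have "2 ^ (m + n) * (1 / 2 ^ (m + n)\<^sup>2) \<le> (1 / 2 ^ (n * (n - 1))) * (1 / (2::real)) ^ m"
    by (simp add: power_add field_simps)
  moreover have "2 ^ (m + n) * dyadic_step (m + n) x \<le> 2 ^ (m + n) * (1 / 2 ^ (m + n)\<^sup>2)"
    by (intro mult_left_mono dyadic_step_le) simp
  ultimately show ?thesis by linarith
qed

lemma summable_height_terms: "summable (\<lambda>n. 2 ^ n * dyadic_step n x)"
\<comment> \<open>Shifting by one reaches the range of \<open>height_term_le\<close>, whose bound
  for n = 1 is (1/2)^m.\<close>
proof (subst summable_iff_shift[of _ 1, symmetric], rule summable_comparison_test)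
  show "\<exists>N. \<forall>m\<ge>N. norm (2 ^ (m + 1) * dyadic_step (m + 1) x) \<le> (1 / 2) ^ m"
    using height_term_le[of 1 _ x] by (simp add: dyadic_step_nonneg)
  show "summable (\<lambda>m. (1 / 2 :: real) ^ m)"
    by (rule summable_geometric) simp
qed

lemma height_tail:
  assumes "1 \<le> n"
  shows "0 \<le> (\<Sum>m. 2 ^ (m + n) * dyadic_step (m + n) x)"
    and "(\<Sum>m. 2 ^ (m + n) * dyadic_step (m + n) x) \<le> 2 / 2 ^ (n * (n - 1))"
proof -
  have s: "summable (\<lambda>m. 2 ^ (m + n) * dyadic_step (m + n) x)"
    using summable_height_terms[of x] by (subst summable_iff_shift)
  show "0 \<le> (\<Sum>m. 2 ^ (m + n) * dyadic_step (m + n) x)"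
    by (rule suminf_nonneg[OF s]) (simp add: dyadic_step_nonneg)
  have "(\<Sum>m. 2 ^ (m + n) * dyadic_step (m + n) x)
      \<le> (\<Sum>m. (1 / 2 ^ (n * (n - 1))) * (1 / 2) ^ m)"
    by (intro suminf_le height_term_le assms s summable_mult summable_geometric) simp
  also have "\<dots> = 2 / 2 ^ (n * (n - 1))"
    by (subst suminf_mult) (simp_all add: suminf_geometric summable_geometric)
  finally show "(\<Sum>m. 2 ^ (m + n) * dyadic_step (m + n) x) \<le> 2 / 2 ^ (n * (n - 1))" .
qed

lemma height_split:
  "height x = - (\<Sum>m. 2 ^ (m + n) * dyadic_step (m + n) x) - (\<Sum>m<n. 2 ^ m * dyadic_step m x)"
  unfolding height_def
  by (subst suminf_split_initial_segment[OF summable_height_terms, of _ n]) simp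

text \<open>The term of index 0 is at most 1 and the tail from index 1 at most 2.\<close>

lemma height_bound: "\<bar>height x\<bar> \<le> 3"
  using height_split[of x 1] height_tail[of 1 x] dyadic_step_bounds[of 0 x] by simp

text \<open>Two errors of opposite sign make the bounds asymmetric: the digits of \<open>x\<close>
  after block n raise the value, the scaled tail of the series lowers it.\<close>

lemma sheared_height_bounds:
  shows "coarse n x - 4 / 2 ^ (Suc n)\<^sup>2 \<le> x + height x / 2 ^ n"
    and "x + height x / 2 ^ n \<le> coarse n x + 1 / 2 ^ (Suc n)\<^sup>2"
proof -
  define t where "t = (\<Sum>m. 2 ^ (m + Suc n) * dyadic_step (m + Suc n) x)"
  have t: "0 \<le> t" "t \<le> 2 / 2 ^ (Suc n * n)"
    using height_tail[of "Suc n" x] by (simp_all add: t_def)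
  have "height x = - t - 2 ^ n * dyadic_step n x - (\<Sum>m<n. 2 ^ m * dyadic_step m x)"
    using height_split[of x "Suc n"] by (simp add: t_def)
  \<comment> \<open>Step n has weight -2^n in \<open>height\<close>, so after division by 2^n it
    turns \<open>dyadic_floor (Suc n) x\<close> into \<open>dyadic_floor n x\<close>.\<close>
  then have eq: "x + height x / 2 ^ n = coarse n x + (x - dyadic_floor (Suc n) x) - t / 2 ^ n"
    by (simp add: coarse_def dyadic_step_def[of n] diff_divide_distrib)
  \<comment> \<open>Since (n+1)^2 = (n+1) n + n + 1, the tail bound 2 / 2^((n+1) n) divided by 2^n
    is exactly 4 / 2^((n+1)^2).\<close>
  have "(2::real) ^ (Suc n)\<^sup>2 = 2 ^ (Suc n * n) * 2 ^ n * 2"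
    by (simp add: power2_eq_square power_add)
  moreover have "t / 2 ^ n \<le> 2 / 2 ^ (Suc n * n) / 2 ^ n"
    using t by (intro divide_right_mono) auto
  ultimately have "t / 2 ^ n \<le> 4 / 2 ^ (Suc n)\<^sup>2"
    by (simp add: mult.commute)
  moreover have "0 \<le> t / 2 ^ n"
    using t by simp
  ultimately show "coarse n x - 4 / 2 ^ (Suc n)\<^sup>2 \<le> x + height x / 2 ^ n"
    "x + height x / 2 ^ n \<le> coarse n x + 1 / 2 ^ (Suc n)\<^sup>2"
    using eq dyadic_floor_le[of "Suc n" x] dyadic_floor_gt[of x "Suc n"] by linarith+
qed

section \<open>The shadows and their length\<close>

lemma coarse_dyadic_floor: "coarse n (dyadic_floor n x) = coarse n x"
proof -
  have "dyadic_floor n (dyadic_floor n x) = dyadic_floor n x"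
    using dyadic_floor_dyadic[of n "\<lfloor>2 ^ n\<^sup>2 * x\<rfloor>"] by (simp add: dyadic_floor_def)
  then have "m \<le> n \<Longrightarrow> dyadic_floor m (dyadic_floor n x) = dyadic_floor m x" for m
    by (rule dyadic_floor_cong)
  then show ?thesis
    by (simp add: coarse_def dyadic_step_def)
qed

lemma sheared_height_in_shadow:
  assumes "0 \<le> x" "x < 1"
  shows "x + height x / 2 ^ n \<in> shadow n"
proof -
  define k where "k = nat \<lfloor>2 ^ n\<^sup>2 * x\<rfloor>"
  have "2 ^ n\<^sup>2 * x < 2 ^ n\<^sup>2 * 1"
    using assms by (intro mult_strict_left_mono) auto
  then have "\<lfloor>2 ^ n\<^sup>2 * x\<rfloor> < 2 ^ n\<^sup>2"
    by (simp add: floor_less_iff)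
  then have "k < 2 ^ n\<^sup>2"
    unfolding k_def by (subst nat_less_iff) (use assms in auto)
  moreover have "real k / 2 ^ n\<^sup>2 = dyadic_floor n x"
    using assms by (simp add: k_def dyadic_floor_def)
  ultimately show ?thesis
    unfolding shadow_def using sheared_height_bounds[where n = n and x = x]
    by (intro UnI1 UN_I[of k]) (simp_all add: coarse_dyadic_floor)
qed

lemma compact_shadow: "compact (shadow n)"
  unfolding shadow_def by (intro compact_Un compact_UN) auto

text \<open>The 2^(n^2) intervals of length 5 / 2^((n+1)^2) add up to (5/2) / 4^n. This is weakened
  to (5/2) / 2^n to match the 1 / 2^n for the vertical segment, and 5/2 + 1 \<le> 4.\<close>

lemma emeasure_shadow: "emeasure lborel (shadow n) \<le> ennreal (4 / 2 ^ n)"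
proof -
  define I where "I k = {coarse n (real k / 2 ^ n\<^sup>2) - 4 / 2 ^ (Suc n)\<^sup>2 ..
                              coarse n (real k / 2 ^ n\<^sup>2) + 1 / 2 ^ (Suc n)\<^sup>2}" for k
  have "emeasure lborel (\<Union>k<2 ^ n\<^sup>2. I k) \<le> (\<Sum>k<2 ^ n\<^sup>2. emeasure lborel (I k))"
    by (intro emeasure_subadditive_finite) (auto simp: I_def)
  also have "\<dots> = (\<Sum>k<(2::nat) ^ n\<^sup>2. ennreal (5 / 2 ^ (Suc n)\<^sup>2))"
    by (intro sum.cong refl, unfold I_def, subst emeasure_lborel_Icc) (auto simp: field_simps)
  also have "\<dots> = ennreal (2 ^ n\<^sup>2 * (5 / 2 ^ (Suc n)\<^sup>2))"
    by (subst sum_ennreal) simp_all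
  also have "2 ^ n\<^sup>2 * (5 / 2 ^ (Suc n)\<^sup>2) = (5 / 2 / 2 ^ n / 2 ^ n :: real)"
    by (simp add: power2_eq_square power_add)
  also have "\<dots> \<le> 5 / 2 / 2 ^ n / 1"
    by (intro divide_left_mono) auto
  finally have "emeasure lborel (\<Union>k<2 ^ n\<^sup>2. I k) \<le> ennreal (5 / 2 / 2 ^ n)"
    by (simp add: ennreal_leI)
  moreover have "emeasure lborel {0..1 / 2 ^ n :: real} \<le> ennreal (1 / 2 ^ n)"
    by (subst emeasure_lborel_Icc) auto
  ultimately have "emeasure lborel (\<Union>k<2 ^ n\<^sup>2. I k) + emeasure lborel {0..1 / 2 ^ n :: real}
      \<le> ennreal (5 / 2 / 2 ^ n) + ennreal (1 / 2 ^ n)"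
    by (rule add_mono)
  moreover have "emeasure lborel (shadow n)
      \<le> emeasure lborel (\<Union>k<2 ^ n\<^sup>2. I k) + emeasure lborel {0..1 / 2 ^ n :: real}"
    unfolding shadow_def I_def by (intro emeasure_subadditive) auto
  ultimately have "emeasure lborel (shadow n) \<le> ennreal (5 / 2 / 2 ^ n) + ennreal (1 / 2 ^ n)"
    by (rule order.trans[rotated])
  also have "\<dots> = ennreal (5 / 2 / 2 ^ n + 1 / 2 ^ n)"
    by (intro ennreal_plus[symmetric]) auto
  also have "\<dots> \<le> ennreal (4 / 2 ^ n)"
    by (intro ennreal_leI) (simp add: field_simps)
  finally show ?thesis .
qed

section \<open>Area of sheared strips\<close>

lemma distr_lborel_Complex: "distr lborel borel (\<lambda>(x, y). Complex x y) = (lborel :: complex measure)"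
proof (rule lborel_eqI[symmetric])
  have cont: "continuous_on UNIV (\<lambda>(x, y). Complex x y)"
    unfolding Complex_eq case_prod_beta by (intro continuous_intros)
  fix l u :: complex
  assume *: "\<And>b. b \<in> Basis \<Longrightarrow> l \<bullet> b \<le> u \<bullet> b"
  have le: "Re l \<le> Re u" "Im l \<le> Im u"
    using *[of 1] *[of \<i>] by (auto simp: Basis_complex_def)
  have vim: "(\<lambda>(x, y). Complex x y) -` box l u = box (Re l, Im l) (Re u, Im u)"
    by (auto simp: box_def Basis_complex_def Basis_prod_def)
  have "emeasure (distr lborel borel (\<lambda>(x, y). Complex x y)) (box l u)
      = emeasure lborel (box (Re l, Im l) (Re u, Im u))"
    using borel_measurable_continuous_onI[OF cont] by (subst emeasure_distr) (simp_all add: vim)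
  also have "\<dots> = ennreal (\<Prod>b\<in>Basis. (u - l) \<bullet> b)"
  proof -
    have "box (Re l, Im l) (Re u, Im u) = box (Re l) (Re u) \<times> box (Im l) (Im u)"
      by (subst box_prod) simp
    then have "emeasure lborel (box (Re l, Im l) (Re u, Im u))
      = emeasure (lborel \<Otimes>\<^sub>M lborel) (box (Re l) (Re u) \<times> box (Im l) (Im u))"
      by (simp add: lborel_prod)
    also have "\<dots> = ennreal (Re u - Re l) * ennreal (Im u - Im l)"
      using le by (subst lborel.emeasure_pair_measure_Times) (auto simp: box_real)
    finally show ?thesis
      using le by (simp add: Basis_complex_def ennreal_mult)
  qed
  finally show "emeasure (distr lborel borel (\<lambda>(x, y). Complex x y)) (box l u)
      = ennreal (\<Prod>b\<in>Basis. (u - l) \<bullet> b)" .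
qed simp

lemma compact_sheared_strip:
  assumes "compact E"
  shows "compact {z. Re z + s * Im z + c \<in> E \<and> \<bar>Im z\<bar> \<le> r}"
proof -
  have "{z. Re z + s * Im z + c \<in> E \<and> \<bar>Im z\<bar> \<le> r}
      = (\<lambda>(x, y). Complex (x - s * y - c) y) ` (E \<times> {-r..r})"
    by (force simp: image_iff complex_eq_iff)
  moreover have "compact ((\<lambda>(x, y). Complex (x - s * y - c) y) ` (E \<times> {-r..r}))"
    unfolding Complex_eq case_prod_beta
    by (intro compact_continuous_image compact_Times assms continuous_intros) auto
  ultimately show ?thesis by simp
qed

text \<open>Cavalieri's principle: in coordinates (x, y), each slice at a height y with
  \<bar>y\<bar> \<le> r is a translate of \<open>E\<close>, so the shear and the offset
  \<open>c\<close> do not change the area.\<close>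

lemma emeasure_sheared_strip:
  assumes "compact E" "0 \<le> r"
  shows "emeasure lborel {z. Re z + s * Im z + c \<in> E \<and> \<bar>Im z\<bar> \<le> r}
    = ennreal (2 * r) * emeasure lborel E"
proof -
  define T where "T = {z. Re z + s * Im z + c \<in> E \<and> \<bar>Im z\<bar> \<le> r}"
  define P where "P = {(x, y). x + s * y + c \<in> E \<and> \<bar>y\<bar> \<le> r}"
  have E: "E \<in> sets borel"
    using assms by (simp add: compact_imp_closed)
  have T: "T \<in> sets borel"
    unfolding T_def using compact_sheared_strip[OF assms(1)] by (simp add: compact_imp_closed)
  have cont: "continuous_on UNIV (\<lambda>(x, y). Complex x y)"
    unfolding Complex_eq case_prod_beta by (intro continuous_intros)
  have meas: "(\<lambda>(x, y). Complex x y) \<in> borel_measurable lborel"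
    using borel_measurable_continuous_onI[OF cont] by simp
  have vim: "(\<lambda>(x, y). Complex x y) -` T = P"
    by (auto simp: T_def P_def)
  have P: "P \<in> sets (lborel \<Otimes>\<^sub>M lborel)"
    using measurable_sets[OF meas T] by (simp only: vim lborel_prod space_lborel space_borel Int_UNIV_right)
  have slice: "emeasure lborel ((\<lambda>x. (x, y)) -` P)
      = emeasure lborel E * indicator {-r..r} y" for y
  proof (cases "\<bar>y\<bar> \<le> r")
    case True
    have "(\<lambda>x. (x, y)) -` P = (+) (s * y + c) -` E"
      using True by (auto simp: P_def algebra_simps)
    moreover have "emeasure lborel ((+) (s * y + c) -` E) = emeasure lborel E"
      using E by (subst (2) lborel_distr_plus[of "s * y + c", symmetric]) (simp add: emeasure_distr)
    ultimately show ?thesis using True by (simp add: indicator_def abs_le_iff)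
  qed (auto simp: P_def indicator_def)
  have "emeasure lborel T = emeasure (distr lborel borel (\<lambda>(x, y). Complex x y)) T"
    by (simp add: distr_lborel_Complex)
  also have "\<dots> = emeasure (lborel \<Otimes>\<^sub>M lborel) P"
    using meas T by (subst emeasure_distr) (simp_all add: vim lborel_prod)
  also have "\<dots> = (\<integral>\<^sup>+ y. emeasure lborel ((\<lambda>x. (x, y)) -` P) \<partial>lborel)"
    by (rule lborel_pair.emeasure_pair_measure_alt2[OF P])
  also have "\<dots> = emeasure lborel E * emeasure lborel {-r..r}"
    unfolding slice by (subst nn_integral_cmult_indicator) auto
  also have "\<dots> = ennreal (2 * r) * emeasure lborel E"
    using assms by (simp add: mult.commute)
  finally show ?thesis
    by (simp add: T_def)
qed

section \<open>Compactness and contents of the set\<close>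

lemma compact_kset: "compact kset"
proof -
  have "kset = {z. \<bar>Re z\<bar> \<le> 1} \<inter> {z. \<bar>Im z\<bar> \<le> 3} \<inter> (\<Inter>n. (\<lambda>z. Re z + Im z / 2 ^ n) -` shadow n)"
    by (auto simp: kset_def)
  moreover have "closed \<dots>"
    using compact_imp_closed[OF compact_shadow]
    by (intro closed_Int closed_INT ballI closed_vimage closed_Collect_le continuous_intros) auto
  ultimately have "closed kset" by simp
  moreover have "bounded kset"
  proof (rule boundedI)
    fix z assume "z \<in> kset"
    then show "norm z \<le> 4"
      using cmod_le[of z] by (auto simp: kset_def)
  qed
  ultimately show ?thesis by (simp add: compact_eq_bounded_closed)
qed

lemma graph_in_kset: "0 \<le> x \<Longrightarrow> x < 1 \<Longrightarrow> Complex x (height x) \<in> kset"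
  using height_bound[of x] sheared_height_in_shadow[of x] by (simp add: kset_def)

lemma segment_in_kset: "0 \<le> y \<Longrightarrow> y \<le> 1 \<Longrightarrow> Complex 0 y \<in> kset"
  by (simp add: kset_def shadow_def divide_right_mono)

section \<open>The movement and the Kakeya property\<close>

definition zigzag :: "nat \<Rightarrow> real \<Rightarrow> complex" where
  "zigzag n t = of_real (min (2 * t) 1) * Complex (1 / 2 ^ n) (- 1)
     + of_real (2 * max 0 (2 * t - 1)) * Complex (- 1 / 2 ^ Suc n) 1"

text \<open>The \<open>min\<close> and \<open>max\<close> factors hold one leg fixed while the other
  runs, which avoids pasting two paths at t = 1/2.\<close>

lemma continuous_on_zigzag: "continuous_on {0..1} (zigzag n)"
  unfolding zigzag_def by (intro continuous_intros)

text \<open>The first leg keeps x + y / 2^n constant and the second keeps x + y / 2^(n+1) constant.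
  The completed first leg has raised the latter by 1 / 2^n - 1 / 2^(n+1) = 1 / 2^(n+1), which the
  offset removes. The path has imaginary part in [-1, 1], hence 3 + 1 = 4.\<close>

lemma swept_zigzag_subset:
  "swept_set (\<lambda>t x. x + zigzag n t) kset
    \<subseteq> {z. Re z + 1 / 2 ^ n * Im z + 0 \<in> shadow n \<and> \<bar>Im z\<bar> \<le> 4}
    \<union> {z. Re z + 1 / 2 ^ Suc n * Im z + (- 1 / 2 ^ Suc n) \<in> shadow (Suc n) \<and> \<bar>Im z\<bar> \<le> 4}"
proof
  fix z assume "z \<in> swept_set (\<lambda>t x. x + zigzag n t) kset"
  then obtain t a where t: "0 \<le> t" "t \<le> 1" and a: "a \<in> kset" and z: "z = a + zigzag n t"
    by (auto simp: swept_set_def)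
  have im: "\<bar>Im a\<bar> \<le> 3" and sh: "Re a + Im a / 2 ^ k \<in> shadow k" for k
    using a by (auto simp: kset_def)
  show "z \<in> {z. Re z + 1 / 2 ^ n * Im z + 0 \<in> shadow n \<and> \<bar>Im z\<bar> \<le> 4}
    \<union> {z. Re z + 1 / 2 ^ Suc n * Im z + (- 1 / 2 ^ Suc n) \<in> shadow (Suc n) \<and> \<bar>Im z\<bar> \<le> 4}"
  proof (cases "t \<le> 1 / 2")
    case True
    then have "Re z + 1 / 2 ^ n * Im z + 0 = Re a + Im a / 2 ^ n"
      by (simp add: z zigzag_def field_simps)
    moreover have "\<bar>Im z\<bar> \<le> 4"
      using True t im by (simp add: z zigzag_def)
    ultimately show ?thesis using sh[of n] by simp
  next
    case False
    then have "Re z + 1 / 2 ^ Suc n * Im z + (- 1 / 2 ^ Suc n) = Re a + Im a / 2 ^ Suc n"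
      by (simp add: z zigzag_def field_simps)
    moreover have "\<bar>Im z\<bar> \<le> 4"
      using False t im by (simp add: z zigzag_def)
    ultimately show ?thesis using sh[of "Suc n"] by simp
  qed
qed

text \<open>Both strips have height 8, so the shadow bounds give 32 / 2^n + 16 / 2^n.\<close>

lemma emeasure_swept_zigzag:
  "emeasure lebesgue (swept_set (\<lambda>t x. x + zigzag n t) kset) \<le> ennreal (48 / 2 ^ n)"
proof -
  define T where "T = {z. Re z + 1 / 2 ^ n * Im z + 0 \<in> shadow n \<and> \<bar>Im z\<bar> \<le> 4}"
  define T' where "T' = {z. Re z + 1 / 2 ^ Suc n * Im z + (- 1 / 2 ^ Suc n) \<in> shadow (Suc n) \<and> \<bar>Im z\<bar> \<le> 4}"
  have sets: "T \<in> sets borel" "T' \<in> sets borel"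
    unfolding T_def T'_def
    by (simp_all only: compact_sheared_strip compact_shadow compact_imp_closed borel_closed)
  have "emeasure lborel T = ennreal (2 * 4) * emeasure lborel (shadow n)"
    unfolding T_def by (rule emeasure_sheared_strip) (auto simp: compact_shadow)
  also have "\<dots> \<le> ennreal (2 * 4) * ennreal (4 / 2 ^ n)"
    by (intro mult_left_mono emeasure_shadow) auto
  finally have 1: "emeasure lborel T \<le> ennreal (32 / 2 ^ n)"
    by (subst (asm) ennreal_mult[symmetric]) simp_all
  have "emeasure lborel T' = ennreal (2 * 4) * emeasure lborel (shadow (Suc n))"
    unfolding T'_def by (rule emeasure_sheared_strip) (auto simp: compact_shadow)
  also have "\<dots> \<le> ennreal (2 * 4) * ennreal (4 / 2 ^ Suc n)"
    by (intro mult_left_mono emeasure_shadow) auto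
  finally have 2: "emeasure lborel T' \<le> ennreal (16 / 2 ^ n)"
    by (subst (asm) ennreal_mult[symmetric]) simp_all
  have "emeasure lebesgue (swept_set (\<lambda>t x. x + zigzag n t) kset) \<le> emeasure lebesgue (T \<union> T')"
    using swept_zigzag_subset[of n] sets unfolding T_def T'_def by (intro emeasure_mono) auto
  also have "\<dots> = emeasure lborel (T \<union> T')"
    using sets by simp
  also have "\<dots> \<le> emeasure lborel T + emeasure lborel T'"
    using sets by (intro emeasure_subadditive) auto
  also have "\<dots> \<le> ennreal (32 / 2 ^ n) + ennreal (16 / 2 ^ n)"
    using 1 2 by (rule add_mono)
  also have "\<dots> = ennreal (48 / 2 ^ n)"
    by (subst ennreal_plus[symmetric]) auto
  finally show ?thesis .
qed

lemma compact_swept_set: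
  assumes "continuous_movement M" "compact A"
  shows "compact (swept_set M A)"
proof -
  have "swept_set M A = (\<lambda>(t, x). M t x) ` ({0..1} \<times> A)"
    unfolding swept_set_def by (auto simp: image_iff) blast+
  moreover have "continuous_on ({0..1} \<times> A) (\<lambda>(t, x). M t x)"
    using assms(1) unfolding continuous_movement_def
    by (elim conjE) (erule continuous_on_subset, auto)
  ultimately show ?thesis
    using assms(2) by (simp add: compact_continuous_image compact_Times)
qed

lemma continuous_movement_zigzag: "continuous_movement (\<lambda>t x. x + zigzag n t)"
  unfolding continuous_movement_def
proof (intro conjI ballI)
  show "rigid_motion (\<lambda>x. x + zigzag n t)" for t
    unfolding rigid_motion_def by (intro exI[of _ 1] exI[of _ "zigzag n t"]) simp
  show "continuous_on ({0..1} \<times> UNIV) (\<lambda>(t, x). x + zigzag n t)"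
    unfolding case_prod_beta
    by (intro continuous_intros continuous_on_compose2[OF continuous_on_zigzag]) auto
  show "(\<lambda>x. x + zigzag n 0) = id"
    by (auto simp: zigzag_def)
qed

lemma kakeya_property_kset: "kakeya_property kset"
  unfolding kakeya_property_def
\<comment> \<open>Every \<open>zigzag n\<close> ends at \<i>, so one motion serves all
  \<epsilon>.\<close>
proof (intro exI[of _ "\<lambda>x. x + \<i>"] conjI allI impI)
  show "rigid_motion (\<lambda>x. x + \<i>)"
    unfolding rigid_motion_def by (intro exI[of _ 1] exI[of _ \<i>]) simp
  show "(\<lambda>x. x + \<i>) \<noteq> id"
    by (auto simp: fun_eq_iff)
  fix \<epsilon> :: real assume "\<epsilon> > 0"
  then obtain n where n: "(1 / 2) ^ n < \<epsilon> / 48"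
    using real_arch_pow_inv[of "\<epsilon> / 48" "1 / 2"] by auto
  let ?M = "\<lambda>t x. x + zigzag n t"
  have lm: "swept_set ?M kset \<in> lmeasurable"
    by (intro lmeasurable_compact compact_swept_set continuous_movement_zigzag compact_kset)
  have "measure lebesgue (swept_set ?M kset) \<le> 48 / 2 ^ n"
    using emeasure_swept_zigzag[of n] by (simp add: measure_def enn2real_leI)
  also have "\<dots> < \<epsilon>"
    using n by (simp add: power_divide field_simps)
  finally have "measure lebesgue (swept_set ?M kset) < \<epsilon>" .
  moreover have "?M 1 = (\<lambda>x. x + \<i>)"
    by (simp add: zigzag_def complex_eq_iff fun_eq_iff)
  ultimately show "\<exists>M. continuous_movement M \<and> M 1 = (\<lambda>x. x + \<i>) \<and>
      swept_set M kset \<in> lmeasurable \<and> measure lebesgue (swept_set M kset) < \<epsilon>"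
    using lm continuous_movement_zigzag by blast
qed

section \<open>Covers by parallel lines and by concentric circles\<close>

lemma open_subset_null_set_empty:
  fixes U :: "complex set"
  assumes "N \<in> null_sets lebesgue" "open U" "U \<subseteq> N"
  shows "U = {}"
  using assms by (metis negligible_iff_null_sets negligible_subset open_not_negligible)

text \<open>With each point of \<open>kset\<close> the cover contains the whole line through it,
  hence an open strip: for vertical lines this comes from the graph, for all others from the
  segment.\<close>

lemma parallel_lines_cover_kset_not_null:
  assumes "union_of_parallel_lines N" "kset \<subseteq> N"
  shows "N \<notin> null_sets lebesgue"
proof
  assume null: "N \<in> null_sets lebesgue"
  from assms obtain v P where v: "v \<noteq> 0" and N: "N = (\<Union>p\<in>P. line_through p v)"
    by (auto simp: union_of_parallel_lines_def)
  have line: "a + of_real s * v \<in> N" if "a \<in> kset" for a s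
  proof -
    from that assms(2) obtain p r where "p \<in> P" "a = p + of_real r * v"
      unfolding N line_through_def by blast
    then show ?thesis
      by (auto simp: N line_through_def algebra_simps intro!: bexI[of _ p] exI[of _ "r + s"])
  qed
  show False
  proof (cases "Re v = 0")
    case True
    have "{z. 0 < Re z} \<inter> {z. Re z < 1} \<subseteq> N"
    proof
      fix z assume z: "z \<in> {z. 0 < Re z} \<inter> {z. Re z < 1}"
      have "Im v \<noteq> 0" using v True by (auto simp: complex_eq_iff)
      then have "z = Complex (Re z) (height (Re z)) + of_real ((Im z - height (Re z)) / Im v) * v"
        using True by (simp add: complex_eq_iff)
      then show "z \<in> N"
        using line[OF graph_in_kset[of "Re z"]] z by (metis IntE less_imp_le mem_Collect_eq)
    qed
    then have "{z. 0 < Re z} \<inter> {z. Re z < 1} = {}"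
      by (intro open_subset_null_set_empty[OF null] open_Int open_Collect_less continuous_intros)
    moreover have "Complex (1 / 2) 0 \<in> {z. 0 < Re z} \<inter> {z. Re z < 1}" by simp
    ultimately show False by blast
  next
    case False
    \<comment> \<open>The height at which the line through \<open>z\<close> in direction
      \<open>v\<close> meets the imaginary axis.\<close>
    define y where "y z = Im z - Re z / Re v * Im v" for z
    have "{z. 0 < y z} \<inter> {z. y z < 1} \<subseteq> N"
    proof
      fix z assume z: "z \<in> {z. 0 < y z} \<inter> {z. y z < 1}"
      have "z = Complex 0 (y z) + of_real (Re z / Re v) * v"
        using False by (simp add: complex_eq_iff y_def)
      then show "z \<in> N"
        using line[OF segment_in_kset[of "y z"]] z by (metis IntE less_imp_le mem_Collect_eq)
    qed
    then have "{z. 0 < y z} \<inter> {z. y z < 1} = {}"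
      unfolding y_def using False
      by (intro open_subset_null_set_empty[OF null] open_Int open_Collect_less continuous_intros) auto
    moreover have "Complex 0 (1 / 2) \<in> {z. 0 < y z} \<inter> {z. y z < 1}" by (simp add: y_def)
    ultimately show False by blast
  qed
qed

text \<open>The distance from the centre is continuous and not constant along the segment, so it
  attains an interval of values and the cover contains an open annulus.\<close>

lemma concentric_circles_cover_kset_not_null:
  assumes "union_of_concentric_circles N" "kset \<subseteq> N"
  shows "N \<notin> null_sets lebesgue"
proof
  assume null: "N \<in> null_sets lebesgue"
  from assms obtain c R where N: "N = (\<Union>r\<in>R. sphere c r)"
    by (auto simp: union_of_concentric_circles_def)
  define d where "d y = dist c (Complex 0 y)" for y
  have circle: "z \<in> N" if "dist c z = d y" "0 \<le> y" "y \<le> 1" for z y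
    using segment_in_kset[of y] assms(2) that by (auto simp: N d_def)
  have cont: "continuous_on {0..1} d"
    unfolding d_def Complex_eq by (intro continuous_intros)
  \<comment> \<open>The square of \<open>d\<close> is a quadratic polynomial with leading
    coefficient 1 and cannot take one value at three points.\<close>
  have "d 0 \<noteq> d (1 / 2) \<or> d (1 / 2) \<noteq> d 1"
  proof (rule ccontr)
    assume "\<not> ?thesis"
    then have "(d 0)\<^sup>2 = (d (1 / 2))\<^sup>2" "(d (1 / 2))\<^sup>2 = (d 1)\<^sup>2" by auto
    then show False
      by (simp add: d_def dist_norm cmod_power2) (simp add: power2_eq_square algebra_simps)
  qed
  then have "\<not> (\<forall>a\<in>{0..1}. \<forall>b\<in>{0..1}. d b \<le> d a)"
    by (force intro: antisym)
  then obtain a b where ab: "a \<in> {0..1}" "b \<in> {0..1}" "d a < d b"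
    by (auto simp: not_le)
  have "connected (d ` {0..1})"
    by (intro connected_continuous_image cont) simp
  then have between: "r \<in> d ` {0..1}" if "d a < r" "r < d b" for r
    using connectedD_interval[of "d ` {0..1}" "d a" "d b" r] ab that by simp
  have "{z. d a < dist c z} \<inter> {z. dist c z < d b} \<subseteq> N"
  proof
    fix z assume "z \<in> {z. d a < dist c z} \<inter> {z. dist c z < d b}"
    with between[of "dist c z"] obtain y where "y \<in> {0..1}" "dist c z = d y"
      by auto
    then show "z \<in> N" by (intro circle) auto
  qed
  then have empty: "{z. d a < dist c z} \<inter> {z. dist c z < d b} = {}"
    by (intro open_subset_null_set_empty[OF null] open_Int open_Collect_less continuous_intros)
  \<comment> \<open>A point at the mean of the two radii shows that the annulus is nonempty.\<close>
  have "dist c (c + of_real r) = \<bar>r\<bar>" for r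
    by (simp add: dist_norm)
  then have "dist c (c + of_real ((d a + d b) / 2)) = \<bar>(d a + d b) / 2\<bar>" .
  moreover have "0 \<le> d a" "0 \<le> d b"
    by (simp_all add: d_def)
  ultimately have "c + of_real ((d a + d b) / 2) \<in> {z. d a < dist c z} \<inter> {z. dist c z < d b}"
    using ab by simp
  with empty show False by blast
qed

theorem mainTheorem3:
  shows "\<exists>A :: complex set. compact A \<and> kakeya_property A \<and> \<not> trivial_K_set A"
  using compact_kset kakeya_property_kset parallel_lines_cover_kset_not_null
    concentric_circles_cover_kset_not_null
  by (auto simp: trivial_K_set_def)

end
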